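(* Let $G$ be a compact Lie group acting smoothly and non-trivially on a smooth connected finite-dimensional manifold $M$. Then the set of fixed points of $G$, that is $\{z\in M \mid g\cdot z=z \text{ for all } g\in G\}$, is nowhere dense in $M$.
   Context: Smooth means $C^\infty$. The action is non-trivial if some element of $G$ moves some point of $M$. *)

theory Defs
  imports "HOL-Analysis.Analysis" "HOL-Algebra.Group_Action"
begin

section \<open>Smooth functions on open subsets of Euclidean space\<close>

text \<open>
  \<^const>\<open>Euclidean_space\<close> \<open>n\<close> is $\mathbb{R}^n$, realised as the sequences \<open>nat \<Rightarrow> real\<close> supported
  on \<open>{..<n}\<close>. It is used instead of the type class \<^class>\<open>euclidean_space\<close> because the latter has no
  instance of dimension 0, and 0-dimensional Lie groups (e.g. the finite groups) have to be covered.
\<close>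

definition partial_deriv :: "nat \<Rightarrow> ((nat \<Rightarrow> real) \<Rightarrow> real) \<Rightarrow> (nat \<Rightarrow> real) \<Rightarrow> real" where
  "partial_deriv i f x = deriv (\<lambda>t. f (x(i := t))) (x i)"

text \<open>
  \<open>Ck_on k n V f\<close>: all iterated partial derivatives of \<open>f\<close> of order at most \<open>k\<close> exist and are
  continuous on \<open>V\<close>. Meaningful for \<open>V\<close> open in \<^const>\<open>Euclidean_space\<close> \<open>n\<close>; then only the values of
  \<open>f\<close> on \<open>V\<close> matter.
\<close>

primrec Ck_on :: "nat \<Rightarrow> nat \<Rightarrow> (nat \<Rightarrow> real) set \<Rightarrow> ((nat \<Rightarrow> real) \<Rightarrow> real) \<Rightarrow> bool" where
  "Ck_on 0 n V f \<longleftrightarrow> continuous_map (subtopology (Euclidean_space n) V) euclideanreal f"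
| "Ck_on (Suc k) n V f \<longleftrightarrow>
     continuous_map (subtopology (Euclidean_space n) V) euclideanreal f \<and>
     (\<forall>i<n. (\<forall>x\<in>V. (\<lambda>t. f (x(i := t))) field_differentiable at (x i)) \<and>
            Ck_on k n V (partial_deriv i f))"

definition smooth_on ::
  "nat \<Rightarrow> nat \<Rightarrow> (nat \<Rightarrow> real) set \<Rightarrow> ((nat \<Rightarrow> real) \<Rightarrow> (nat \<Rightarrow> real)) \<Rightarrow> bool" where
  "smooth_on n m V f \<longleftrightarrow> (\<forall>j<m. \<forall>k. Ck_on k n V (\<lambda>x. f x j))"


section \<open>Smooth manifolds and smooth maps\<close>

text \<open>A chart is a pair of a domain and a map; the map is irrelevant outside the domain.\<close>

type_synonym 'a chart = "'a set \<times> ('a \<Rightarrow> nat \<Rightarrow> real)"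

text \<open>The atlas need not be maximal; it stands for the smooth structure it generates.\<close>

record 'a mfd =
  mfd_dim :: nat
  mfd_top :: "'a topology"
  mfd_atlas :: "'a chart set"

abbreviation points :: "'a mfd \<Rightarrow> 'a set" where
  "points M \<equiv> topspace (mfd_top M)"

definition is_chart :: "nat \<Rightarrow> 'a topology \<Rightarrow> 'a chart \<Rightarrow> bool" where
  "is_chart n X c \<longleftrightarrow> (case c of (U, \<phi>) \<Rightarrow>
     openin X U \<and> openin (Euclidean_space n) (\<phi> ` U) \<and>
     homeomorphic_map (subtopology X U) (subtopology (Euclidean_space n) (\<phi> ` U)) \<phi>)"

definition smooth_manifold :: "'a mfd \<Rightarrow> bool" where
  "smooth_manifold M \<longleftrightarrow>
     Hausdorff_space (mfd_top M) \<and> second_countable (mfd_top M) \<and>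
     (\<forall>c\<in>mfd_atlas M. is_chart (mfd_dim M) (mfd_top M) c) \<and>
     (\<Union>(U, \<phi>)\<in>mfd_atlas M. U) = points M \<and>
     (\<forall>(U, \<phi>)\<in>mfd_atlas M. \<forall>(W, \<psi>)\<in>mfd_atlas M.
        smooth_on (mfd_dim M) (mfd_dim M) (\<phi> ` (U \<inter> W)) (\<psi> \<circ> inv_into U \<phi>))"

text \<open>Continuity of \<open>f\<close> makes the domains \<open>\<phi> ` {p \<in> U. f p \<in> W}\<close> of its local representatives open.\<close>

definition smooth_map :: "'a mfd \<Rightarrow> 'b mfd \<Rightarrow> ('a \<Rightarrow> 'b) \<Rightarrow> bool" where
  "smooth_map M N f \<longleftrightarrow>
     continuous_map (mfd_top M) (mfd_top N) f \<and>
     (\<forall>(U, \<phi>)\<in>mfd_atlas M. \<forall>(W, \<psi>)\<in>mfd_atlas N.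
        smooth_on (mfd_dim M) (mfd_dim N) (\<phi> ` {p \<in> U. f p \<in> W}) (\<psi> \<circ> f \<circ> inv_into U \<phi>))"

text \<open>The identification of $\mathbb{R}^m \times \mathbb{R}^n$ with $\mathbb{R}^{m+n}$.\<close>

definition join_coords :: "nat \<Rightarrow> (nat \<Rightarrow> real) \<Rightarrow> (nat \<Rightarrow> real) \<Rightarrow> nat \<Rightarrow> real" where
  "join_coords m x y = (\<lambda>i. if i < m then x i else y (i - m))"

definition prod_mfd :: "'a mfd \<Rightarrow> 'b mfd \<Rightarrow> ('a \<times> 'b) mfd" where
  "prod_mfd M N =
     \<lparr>mfd_dim = mfd_dim M + mfd_dim N,
      mfd_top = prod_topology (mfd_top M) (mfd_top N),
      mfd_atlas = {(U \<times> W, \<lambda>(p, q). join_coords (mfd_dim M) (\<phi> p) (\<psi> q)) | U \<phi> W \<psi>.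
                    (U, \<phi>) \<in> mfd_atlas M \<and> (W, \<psi>) \<in> mfd_atlas N}\<rparr>"


section \<open>Lie groups and smooth actions\<close>

definition lie_group :: "('g, 'r) monoid_scheme \<Rightarrow> 'g mfd \<Rightarrow> bool" where
  "lie_group G L \<longleftrightarrow>
     group G \<and> smooth_manifold L \<and> carrier G = points L \<and>
     smooth_map (prod_mfd L L) L (\<lambda>(g, h). g \<otimes>\<^bsub>G\<^esub> h) \<and>
     smooth_map L L (\<lambda>g. inv\<^bsub>G\<^esub> g)"

text \<open>
  In \<^const>\<open>group_action\<close> each \<open>\<alpha> g\<close> is extensional, i.e. normalised to be \<open>undefined\<close> off \<open>points M\<close>.
\<close>

definition smooth_action ::
  "('g, 'r) monoid_scheme \<Rightarrow> 'g mfd \<Rightarrow> 'm mfd \<Rightarrow> ('g \<Rightarrow> 'm \<Rightarrow> 'm) \<Rightarrow> bool" where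
  "smooth_action G L M \<alpha> \<longleftrightarrow>
     group_action G (points M) \<alpha> \<and> smooth_map (prod_mfd L M) M (\<lambda>(g, z). \<alpha> g z)"

definition nowhere_dense_in :: "'a topology \<Rightarrow> 'a set \<Rightarrow> bool" where
  "nowhere_dense_in X S \<longleftrightarrow> S \<subseteq> topspace X \<and> X interior_of (X closure_of S) = {}"

end

theory Submission
  imports Defs
begin

text \<open>
  Let \<open>F\<close> be the fixed point set and \<open>A\<close> its interior. Since \<open>F\<close> is closed, it suffices to show that
  \<open>A\<close> is empty, and since \<open>M\<close> is connected and the action is non-trivial, it suffices to show
  that \<open>A\<close> is closed. So let \<open>z\<close> be in the closure of \<open>A\<close>; then \<open>z\<close> is a fixed point and has to be
  shown to have a neighbourhood of fixed points.

  At points of \<open>A\<close> every \<open>g\<close> has the identity as its derivative in a chart \<open>\<phi>\<close> around \<open>z\<close>. The derivative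
  depends continuously on the pair of \<open>g\<close> and the point, so at \<open>z\<close> it is the identity as well, and by
  compactness of \<open>G\<close> it is uniformly close to the identity on a box around \<open>\<phi> z\<close>
  (\<open>smooth_action_derivative_near_identity\<close> and the tube lemma).

  The usual way to finish is to linearise the action near \<open>z\<close> by averaging over Haar measure. The
  following direct argument uses no invariant measure. Take \<open>q\<close> so close to \<open>z\<close> that its whole orbit stays
  in the box, and let \<open>d g\<close> be the coordinate distance from \<open>q\<close> to \<open>g q\<close>. The displacement of a map
  whose derivative is close to the identity varies slowly, so going from \<open>g q\<close> to \<open>g (g q)\<close> nearly
  repeats the step from \<open>q\<close> to \<open>g q\<close>; hence \<open>d (g g) \<ge> 3/2 * d g\<close> (\<open>near_identity_doubling\<close>). As \<open>d\<close> is
  bounded on the group, it vanishes identically (\<open>bounded_self_improving_eq_0\<close>), that is, \<open>q\<close> is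
  a fixed point.
\<close>

section \<open>Boxes and coordinate lines in charts\<close>

lemma Euclidean_space_open_contains_box:
  assumes "openin (Euclidean_space n) T" and "y \<in> T"
  obtains r where "r > 0"
    and "\<And>x. x \<in> topspace (Euclidean_space n) \<Longrightarrow> (\<And>i. i < n \<Longrightarrow> \<bar>x i - y i\<bar> < r) \<Longrightarrow> x \<in> T"
proof -
  obtain O' where O': "openin (powertop_real UNIV) O'" "T = O' \<inter> {x. \<forall>i\<ge>n. x i = 0}"
    using assms(1) by (auto simp: Euclidean_space_def openin_subtopology)
  have "y \<in> O'" using O'(2) assms(2) by blast
  then obtain B where "\<forall>i\<in>UNIV. openin euclideanreal (B i)" "y \<in> Pi\<^sub>E UNIV B" "Pi\<^sub>E UNIV B \<subseteq> O'"
    using O'(1) unfolding openin_product_topology_alt by blast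
  then have op: "\<And>i. open (B i)" and yB: "\<And>i. y i \<in> B i" and sub: "\<And>x. (\<And>i. x i \<in> B i) \<Longrightarrow> x \<in> O'"
    by (auto simp: PiE_iff subset_iff)
  have "\<forall>i. \<exists>e>0. \<forall>t. \<bar>t - y i\<bar> < e \<longrightarrow> t \<in> B i"
    using op yB by (metis open_dist dist_real_def)
  then obtain e where e: "\<And>i. e i > 0" "\<And>i t. \<bar>t - y i\<bar> < e i \<Longrightarrow> t \<in> B i" by metis
  define r where "r = Min (insert 1 (e ` {..<n}))"
  show thesis
  proof
    show "r > 0" using e(1) by (auto simp: r_def)
    fix x assume x: "x \<in> topspace (Euclidean_space n)" and near: "\<And>i. i < n \<Longrightarrow> \<bar>x i - y i\<bar> < r"
    have "x i \<in> B i" for i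
    proof (cases "i < n")
      case True
      then have "r \<le> e i" by (auto simp: r_def)
      with near[OF True] show ?thesis by (intro e(2)) linarith
    next
      case False
      then have "x i = y i" using x assms(2) O'(2) by (auto simp: topspace_Euclidean_space)
      then show ?thesis using yB by simp
    qed
    with sub x O'(2) show "x \<in> T" by (auto simp: topspace_Euclidean_space)
  qed
qed

lemma is_chartD:
  assumes "is_chart n X (W, \<phi>)"
  shows "openin X W" and "inj_on \<phi> W"
    and "\<And>p. p \<in> W \<Longrightarrow> \<phi> p \<in> topspace (Euclidean_space n)"
    and "continuous_map (subtopology X W) (Euclidean_space n) \<phi>"
    and "\<And>S. openin X S \<Longrightarrow> S \<subseteq> W \<Longrightarrow> openin (Euclidean_space n) (\<phi> ` S)"
proof -
  have W: "openin X W" and op: "openin (Euclidean_space n) (\<phi> ` W)"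
    and homeo: "homeomorphic_map (subtopology X W) (subtopology (Euclidean_space n) (\<phi> ` W)) \<phi>"
    using assms by (auto simp: is_chart_def)
  show "openin X W" by fact
  have ts: "topspace (subtopology X W) = W" using W openin_subset by (metis topspace_subtopology_subset)
  show "inj_on \<phi> W" using homeomorphic_imp_injective_map[OF homeo] ts by simp
  show "\<phi> p \<in> topspace (Euclidean_space n)" if "p \<in> W" for p
    using openin_subset[OF op] that by blast
  show "continuous_map (subtopology X W) (Euclidean_space n) \<phi>"
    using homeomorphic_imp_continuous_map[OF homeo] continuous_map_into_fulltopology by blast
  show "openin (Euclidean_space n) (\<phi> ` S)" if "openin X S" "S \<subseteq> W" for S
  proof -
    have "openin (subtopology X W) S" using that openin_subtopology_Int2 W openin_open_subtopology by blast
    then have "openin (subtopology (Euclidean_space n) (\<phi> ` W)) (\<phi> ` S)"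
      using homeomorphic_imp_open_map[OF homeo] by (simp add: open_map_def)
    then show ?thesis using op openin_trans_full by blast
  qed
qed

lemma continuous_map_Euclidean_space_component:
  "continuous_map (Euclidean_space n) euclideanreal (\<lambda>x. x i)"
  unfolding Euclidean_space_def
  by (intro continuous_map_from_subtopology continuous_map_product_projection) simp

lemma is_chart_continuous_component:
  assumes "is_chart n X (W, \<phi>)"
  shows "continuous_map (subtopology X W) euclideanreal (\<lambda>p. \<phi> p i)"
  using continuous_map_compose[OF is_chartD(4)[OF assms] continuous_map_Euclidean_space_component]
  by (simp add: comp_def)

lemma openin_chart_box:
  assumes "is_chart n X (W, \<phi>)"
  shows "openin X {p \<in> W. \<forall>i<n. \<bar>\<phi> p i - c i\<bar> < r}"
proof -
  have W: "openin X W" and ts: "topspace (subtopology X W) = W"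
    using is_chartD(1)[OF assms] openin_subset by (metis topspace_subtopology_subset)+
  have "openin (subtopology X W) {p \<in> W. \<bar>\<phi> p i - c i\<bar> < r}" for i
  proof -
    have "openin (subtopology X W) {p \<in> topspace (subtopology X W). \<phi> p i \<in> {t. \<bar>t - c i\<bar> < r}}"
    proof (rule openin_continuous_map_preimage[OF is_chart_continuous_component[OF assms]])
      have "{t. \<bar>t - c i\<bar> < r} = ball (c i) r" by (auto simp: dist_real_def)
      then show "openin euclideanreal {t. \<bar>t - c i\<bar> < r}" by simp
    qed
    then show ?thesis by (simp only: ts mem_Collect_eq)
  qed
  then have "openin (subtopology X W)
      ((\<Inter>i\<in>{..<n}. {p \<in> W. \<bar>\<phi> p i - c i\<bar> < r}) \<inter> topspace (subtopology X W))"
    by (intro openin_INT) auto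
  also have "(\<Inter>i\<in>{..<n}. {p \<in> W. \<bar>\<phi> p i - c i\<bar> < r}) \<inter> topspace (subtopology X W) =
      {p \<in> W. \<forall>i<n. \<bar>\<phi> p i - c i\<bar> < r}"
    unfolding ts by auto
  finally show ?thesis by (simp add: openin_open_subtopology[OF W])
qed

text \<open>
  Partial derivatives only see a function along coordinate lines, and these stay in the image of
  the chart for a short time. This is what makes the partial derivatives of a local representative
  independent of the arbitrary values that \<^const>\<open>inv_into\<close> takes outside that image.
\<close>
lemma eventually_coordinate_line_in_chart:
  assumes "is_chart n X (W, \<phi>)" and "openin X S" "S \<subseteq> W" "p \<in> S" "i < n"
  shows "\<forall>\<^sub>F t in nhds (\<phi> p i). (\<phi> p)(i := t) \<in> \<phi> ` S"
proof -
  have "p \<in> W" using assms by blast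
  obtain r where r: "r > 0"
    "\<And>x. x \<in> topspace (Euclidean_space n) \<Longrightarrow> (\<And>k. k < n \<Longrightarrow> \<bar>x k - \<phi> p k\<bar> < r) \<Longrightarrow> x \<in> \<phi> ` S"
    using Euclidean_space_open_contains_box[OF is_chartD(5)[OF assms(1-3)] imageI[OF assms(4)]] by metis
  have "(\<phi> p)(i := t) \<in> \<phi> ` S" if "dist t (\<phi> p i) < r" for t
  proof (rule r(2))
    show "(\<phi> p)(i := t) \<in> topspace (Euclidean_space n)"
      using is_chartD(3)[OF assms(1) \<open>p \<in> W\<close>] \<open>i < n\<close> by (auto simp: topspace_Euclidean_space)
    show "\<bar>((\<phi> p)(i := t)) k - \<phi> p k\<bar> < r" for k using that r(1) by (simp add: dist_real_def)
  qed
  with r(1) show ?thesis unfolding eventually_nhds_metric by blast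
qed

section \<open>Partial derivatives of a smooth map on a product\<close>

lemma continuous_map_join_coords:
  assumes f: "continuous_map X (Euclidean_space m) f" and g: "continuous_map X (Euclidean_space n) g"
  shows "continuous_map X (Euclidean_space (m + n)) (\<lambda>x. join_coords m (f x) (g x))"
proof -
  have "continuous_map X euclideanreal (\<lambda>x. join_coords m (f x) (g x) i)" for i
    using continuous_map_compose[OF f continuous_map_Euclidean_space_component[of _ i]]
      continuous_map_compose[OF g continuous_map_Euclidean_space_component[of _ "i - m"]]
    by (cases "i < m") (simp_all add: join_coords_def comp_def)
  moreover have "join_coords m (f x) (g x) i = 0" if "x \<in> topspace X" "i \<ge> m + n" for x i
    using continuous_map_image_subset_topspace[OF g] that
    by (auto simp: join_coords_def topspace_Euclidean_space image_subset_iff)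
  ultimately show ?thesis
    by (auto simp: Euclidean_space_def continuous_map_in_subtopology continuous_map_componentwise_UNIV)
qed

text \<open>A single component \<open>j\<close> of the local representative of \<open>h\<close>, so that \<^const>\<open>partial_deriv\<close> applies.\<close>
definition chart_rep ::
    "'a chart \<Rightarrow> 'b chart \<Rightarrow> ('a \<Rightarrow> 'b) \<Rightarrow> nat \<Rightarrow> (nat \<Rightarrow> real) \<Rightarrow> real" where
  "chart_rep c d h j y = snd d (h (inv_into (fst c) (snd c) y)) j"

lemma chart_rep_apply:
  "inj_on \<phi> W \<Longrightarrow> p \<in> W \<Longrightarrow> chart_rep (W, \<phi>) (V, \<psi>) h j (\<phi> p) = \<psi> (h p) j"
  by (simp add: chart_rep_def)

lemma openin_product_chart_domain:
  assumes f: "continuous_map (prod_topology X Y) Z f"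
    and "openin X U" "openin Y W" "openin Z V"
  shows "openin (prod_topology X Y) {x \<in> U \<times> W. f x \<in> V}"
proof -
  have UW: "openin (prod_topology X Y) (U \<times> W)" using assms by (simp add: openin_prod_Times_iff)
  have "{x \<in> U \<times> W. f x \<in> V} = (U \<times> W) \<inter> {x \<in> topspace (prod_topology X Y). f x \<in> V}"
    using openin_subset[OF UW] by blast
  then show ?thesis using openin_Int[OF UW openin_continuous_map_preimage[OF f assms(4)]] by simp
qed

text \<open>
  Smoothness of \<open>f\<close> on the product is expressed in charts of both factors, whereas the derivative in the
  direction of the second factor can be formed with the first argument \<open>g\<close> held fixed as an abstract
  point. The two agree because \<open>\<phi>\<close> occupies the coordinates from \<open>mfd_dim L\<close> on, so moving coordinate
  \<open>mfd_dim L + i\<close> of the product moves coordinate \<open>i\<close> of the second factor alone. The resulting partial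
  derivative no longer mentions \<open>\<theta>\<close>, so it can be compared over all of the first factor, which
  single charts do not cover.
\<close>
lemma smooth_map_prod_partial_deriv:
  fixes L :: "'a mfd" and M :: "'b mfd" and N :: "'c mfd"
  assumes f: "smooth_map (prod_mfd L M) N f"
    and U: "(U, \<theta>) \<in> mfd_atlas L" "is_chart (mfd_dim L) (mfd_top L) (U, \<theta>)"
    and W: "(W, \<phi>) \<in> mfd_atlas M" "is_chart (mfd_dim M) (mfd_top M) (W, \<phi>)"
    and V: "(V, \<psi>) \<in> mfd_atlas N" "openin (mfd_top N) V"
    and i: "i < mfd_dim M" and j: "j < mfd_dim N"
  defines "D \<equiv> {x \<in> U \<times> W. f x \<in> V}"
    and "h \<equiv> \<lambda>g. chart_rep (W, \<phi>) (V, \<psi>) (\<lambda>q. f (g, q)) j"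
  shows "\<And>g p. (g, p) \<in> D \<Longrightarrow> (\<lambda>t. h g ((\<phi> p)(i := t))) field_differentiable at (\<phi> p i)"
    and "continuous_map (subtopology (prod_topology (mfd_top L) (mfd_top M)) D) euclideanreal
           (\<lambda>(g, p). partial_deriv i (h g) (\<phi> p))"
proof -
  define m n X where "m = mfd_dim L" and "n = mfd_dim M"
    and "X = prod_topology (mfd_top L) (mfd_top M)"
  define \<Phi> where "\<Phi> = (\<lambda>(g, p). join_coords m (\<theta> g) (\<phi> p))"
  define F where "F = (\<lambda>x. (\<psi> \<circ> f \<circ> inv_into (U \<times> W) \<Phi>) x j)"
  have UX: "openin (mfd_top L) U" "openin (mfd_top M) W"
    using is_chartD(1)[OF U(2)] is_chartD(1)[OF W(2)] .
  have cf: "continuous_map X (mfd_top N) f" using f by (simp add: smooth_map_def prod_mfd_def X_def)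
  have D: "openin X D"
    unfolding D_def X_def by (rule openin_product_chart_domain[OF cf[unfolded X_def] UX V(2)])
  have Dts: "topspace (subtopology X D) = D" using openin_subset[OF D] by auto
  have "(U \<times> W, \<Phi>) \<in> mfd_atlas (prod_mfd L M)"
    using U(1) W(1) by (auto simp: prod_mfd_def \<Phi>_def m_def)
  then have "smooth_on (m + n) (mfd_dim N) (\<Phi> ` D) (\<psi> \<circ> f \<circ> inv_into (U \<times> W) \<Phi>)"
    using f V(1) unfolding smooth_map_def D_def
    by (fastforce simp: prod_mfd_def m_def n_def)
  then have "Ck_on (Suc 0) (m + n) (\<Phi> ` D) F" using j unfolding smooth_on_def F_def by blast
  then have diff: "\<And>x. x \<in> \<Phi> ` D \<Longrightarrow> (\<lambda>t. F (x(m + i := t))) field_differentiable at (x (m + i))"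
    and cont: "continuous_map (subtopology (Euclidean_space (m + n)) (\<Phi> ` D)) euclideanreal
        (partial_deriv (m + i) F)"
    using i by (auto simp: n_def)
  have inj: "inj_on \<Phi> (U \<times> W)"
  proof (rule inj_onI, clarify)
    fix g p g' p' assume g: "g \<in> U" "g' \<in> U" "p \<in> W" "p' \<in> W" and eq: "\<Phi> (g, p) = \<Phi> (g', p')"
    have "\<theta> g k = \<theta> g' k" for k
      using fun_cong[OF eq, of k] is_chartD(3)[OF U(2)] g
      by (cases "k < m") (auto simp: \<Phi>_def join_coords_def topspace_Euclidean_space m_def)
    moreover have "\<phi> p k = \<phi> p' k" for k
      using fun_cong[OF eq, of "m + k"] by (auto simp: \<Phi>_def join_coords_def)
    ultimately show "g = g' \<and> p = p'"
      using is_chartD(2)[OF U(2)] is_chartD(2)[OF W(2)] g by (auto simp: inj_on_def fun_eq_iff)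
  qed
  \<comment> \<open>Equality holds only near \<open>\<phi> p i\<close>: further out, both \<^const>\<open>inv_into\<close> terms are arbitrary.\<close>
  have local: "\<forall>\<^sub>F t in nhds (\<phi> p i). F ((\<Phi> (g, p))(m + i := t)) = h g ((\<phi> p)(i := t))"
    if gp: "(g, p) \<in> D" for g p
  proof -
    have g: "g \<in> U" "p \<in> W" using gp by (auto simp: D_def)
    show ?thesis
      using eventually_coordinate_line_in_chart[OF W(2) UX(2) order_refl g(2) i]
    proof eventually_elim
      case (elim t)
      then obtain q where q: "q \<in> W" "(\<phi> p)(i := t) = \<phi> q" by blast
      have "(\<Phi> (g, p))(m + i := t) = join_coords m (\<theta> g) ((\<phi> p)(i := t))"
        by (auto simp: \<Phi>_def join_coords_def fun_eq_iff)
      also have "\<dots> = \<Phi> (g, q)" by (simp add: \<Phi>_def q(2))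
      finally show ?case
        using inv_into_f_f[OF inj, of "(g, q)"] g q
        by (simp add: F_def h_def chart_rep_apply[OF is_chartD(2)[OF W(2)] q(1)])
    qed
  qed
  have coord: "\<Phi> (g, p) (m + i) = \<phi> p i" for g p by (simp add: \<Phi>_def join_coords_def)
  show "(\<lambda>t. h g ((\<phi> p)(i := t))) field_differentiable at (\<phi> p i)" if gp: "(g, p) \<in> D" for g p
    using diff[OF imageI[OF gp]] unfolding field_differentiable_def coord
    by (simp only: DERIV_cong_ev[OF refl local[OF gp] refl])
  have "continuous_map (subtopology X D) (Euclidean_space (m + n)) \<Phi>"
    unfolding \<Phi>_def split_def
  proof (rule continuous_map_join_coords)
    have "continuous_map (subtopology X D) (subtopology (mfd_top L) U) fst"
      unfolding X_def by (auto simp: continuous_map_in_subtopology D_def intro: continuous_map_from_subtopology continuous_map_fst)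
    from continuous_map_compose[OF this is_chartD(4)[OF U(2)]]
    show "continuous_map (subtopology X D) (Euclidean_space m) (\<lambda>x. \<theta> (fst x))"
      by (simp add: comp_def m_def)
    have "continuous_map (subtopology X D) (subtopology (mfd_top M) W) snd"
      unfolding X_def by (auto simp: continuous_map_in_subtopology D_def intro: continuous_map_from_subtopology continuous_map_snd)
    from continuous_map_compose[OF this is_chartD(4)[OF W(2)]]
    show "continuous_map (subtopology X D) (Euclidean_space n) (\<lambda>x. \<phi> (snd x))"
      by (simp add: comp_def n_def)
  qed
  then have "continuous_map (subtopology X D) (subtopology (Euclidean_space (m + n)) (\<Phi> ` D)) \<Phi>"
    by (auto simp: continuous_map_in_subtopology)
  from continuous_map_compose[OF this cont]
  have "continuous_map (subtopology X D) euclideanreal (\<lambda>x. partial_deriv (m + i) F (\<Phi> x))"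
    by (simp add: comp_def)
  moreover have "partial_deriv (m + i) F (\<Phi> x) = (\<lambda>(g, p). partial_deriv i (h g) (\<phi> p)) x"
    if "x \<in> D" for x
  proof -
    obtain g p where "x = (g, p)" by (cases x)
    then show ?thesis
      using deriv_cong_ev[OF local refl, of g p] that by (simp add: partial_deriv_def coord)
  qed
  ultimately show "continuous_map (subtopology (prod_topology (mfd_top L) (mfd_top M)) D) euclideanreal
      (\<lambda>(g, p). partial_deriv i (h g) (\<phi> p))"
    unfolding X_def[symmetric] by (rule continuous_map_eq) (simp add: Dts)
qed

lemma partial_deriv_chart_rep_identity:
  assumes W: "is_chart n X (W, \<phi>)" and A: "openin X A" "A \<subseteq> W" "p \<in> A" "i < n"
    and id: "\<And>q. q \<in> A \<Longrightarrow> h q = q"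
  shows "partial_deriv i (chart_rep (W, \<phi>) (W, \<phi>) h j) (\<phi> p) = (if i = j then 1 else 0)"
proof -
  have "\<forall>\<^sub>F t in nhds (\<phi> p i).
      chart_rep (W, \<phi>) (W, \<phi>) h j ((\<phi> p)(i := t)) = (if i = j then t else \<phi> p j)"
    using eventually_coordinate_line_in_chart[OF W A]
  proof eventually_elim
    case (elim t)
    then obtain q where q: "q \<in> A" "(\<phi> p)(i := t) = \<phi> q" by blast
    then have "chart_rep (W, \<phi>) (W, \<phi>) h j ((\<phi> p)(i := t)) = ((\<phi> p)(i := t)) j"
      using id by (simp add: chart_rep_apply[OF is_chartD(2)[OF W] subsetD[OF A(2) q(1)]])
    then show ?case by auto
  qed
  from deriv_cong_ev[OF this refl] show ?thesis by (simp add: partial_deriv_def)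
qed

section \<open>Maps whose derivative is close to the identity\<close>

text \<open>
  Only partial derivatives are available, so \<open>x\<close> is changed into \<open>y\<close> one coordinate at a time; every
  intermediate point stays in the box, and the one-dimensional mean value estimate applies to each move.
  Measuring the distance by the sum of the coordinate distances makes the moves add up exactly, and it
  covers dimension 0.
\<close>
lemma coordinatewise_lipschitz_on_box:
  fixes f :: "(nat \<Rightarrow> real) \<Rightarrow> real" and c :: "nat \<Rightarrow> real" and r e :: real and n :: nat
  defines "B \<equiv> {x \<in> topspace (Euclidean_space n). \<forall>i<n. \<bar>x i - c i\<bar> < r}"
  assumes diff: "\<And>x i. x \<in> B \<Longrightarrow> i < n \<Longrightarrow>
      \<exists>D. ((\<lambda>t. f (x(i := t))) has_real_derivative D) (at (x i)) \<and> \<bar>D\<bar> \<le> e"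
    and x: "x \<in> B" and y: "y \<in> B"
  shows "\<bar>f y - f x\<bar> \<le> e * (\<Sum>i<n. \<bar>y i - x i\<bar>)"
proof -
  define w where "w k = (\<lambda>i. if i < k then y i else x i)" for k
  have wB: "(w k)(k := t) \<in> B" if "k < n" "\<bar>t - c k\<bar> < r" for k t
    using that x y by (auto simp: B_def w_def topspace_Euclidean_space)
  have step: "\<bar>f (w (Suc k)) - f (w k)\<bar> \<le> e * \<bar>y k - x k\<bar>" if "k < n" for k
  proof -
    define h where "h t = f ((w k)(k := t))" for t
    define I where "I = {t. \<bar>t - c k\<bar> < r}"
    have I: "I = ball (c k) r" by (auto simp: I_def dist_real_def)
    have "\<forall>t\<in>I. \<exists>D. (h has_real_derivative D) (at t) \<and> \<bar>D\<bar> \<le> e"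
      using diff[OF wB[OF that] that] by (simp add: h_def[abs_def] I_def)
    then obtain D where D: "\<And>t. t \<in> I \<Longrightarrow> (h has_real_derivative D t) (at t) \<and> \<bar>D t\<bar> \<le> e" by metis
    have "norm (h (y k) - h (x k)) \<le> e * norm (y k - x k)"
    proof (rule field_differentiable_bound)
      show "convex I" by (simp add: I)
      show "(h has_field_derivative D t) (at t within I)" if "t \<in> I" for t
        using D[OF that] has_field_derivative_at_within by blast
      show "norm (D t) \<le> e" if "t \<in> I" for t using D[OF that] by simp
      show "y k \<in> I" "x k \<in> I" using x y that by (auto simp: B_def I_def)
    qed
    moreover have "(w k)(k := y k) = w (Suc k)" "(w k)(k := x k) = w k"
      by (auto simp: w_def fun_eq_iff less_Suc_eq)
    ultimately show ?thesis by (simp add: h_def)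
  qed
  have "w n = y" "w 0 = x"
    using x y by (auto simp: w_def B_def topspace_Euclidean_space fun_eq_iff)
  then have "f y - f x = (\<Sum>k<n. f (w (Suc k)) - f (w k))"
    using sum_lessThan_telescope[of "\<lambda>k. f (w k)" n] by simp
  also have "\<bar>\<dots>\<bar> \<le> (\<Sum>k<n. e * \<bar>y k - x k\<bar>)"
    by (intro order_trans[OF sum_abs] sum_mono step) simp
  finally show ?thesis by (simp add: sum_distrib_left)
qed

text \<open>
  Here \<open>y\<close> is the image of \<open>x\<close> under \<open>H\<close>. The displacement of a point under \<open>H\<close> has derivative at most \<open>e\<close>
  in every coordinate, so the displacements of \<open>x\<close> and \<open>y\<close> differ by at most half the distance of \<open>x\<close> and \<open>y\<close>.
  Two consecutive displacements therefore cannot cancel.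
\<close>
lemma near_identity_doubling:
  fixes H :: "nat \<Rightarrow> (nat \<Rightarrow> real) \<Rightarrow> real" and c :: "nat \<Rightarrow> real" and r e :: real and n :: nat
  defines "B \<equiv> {x \<in> topspace (Euclidean_space n). \<forall>i<n. \<bar>x i - c i\<bar> < r}"
  assumes diff: "\<And>x i j. x \<in> B \<Longrightarrow> i < n \<Longrightarrow> j < n \<Longrightarrow>
      \<exists>D. ((\<lambda>t. H j (x(i := t))) has_real_derivative D) (at (x i)) \<and>
          \<bar>D - (if i = j then 1 else 0)\<bar> \<le> e"
    and e: "real n * e \<le> 1 / 2"
    and x: "x \<in> B" and y: "y \<in> B" and Hx: "\<And>j. j < n \<Longrightarrow> H j x = y j"
  shows "3 / 2 * (\<Sum>j<n. \<bar>y j - x j\<bar>) \<le> (\<Sum>j<n. \<bar>H j y - x j\<bar>)"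
proof -
  define s where "s = (\<Sum>j<n. \<bar>y j - x j\<bar>)"
  have "s \<ge> 0" by (simp add: s_def sum_nonneg)
  have err: "\<bar>(H j y - y j) - (H j x - x j)\<bar> \<le> e * s" if "j < n" for j
    unfolding s_def
  proof (rule coordinatewise_lipschitz_on_box[where f = "\<lambda>x. H j x - x j" and c = c and r = r and n = n])
    show "x \<in> {x \<in> topspace (Euclidean_space n). \<forall>i<n. \<bar>x i - c i\<bar> < r}"
      "y \<in> {x \<in> topspace (Euclidean_space n). \<forall>i<n. \<bar>x i - c i\<bar> < r}"
      using x y by (simp_all add: B_def)
    fix u i assume u: "u \<in> {x \<in> topspace (Euclidean_space n). \<forall>i<n. \<bar>x i - c i\<bar> < r}" "i < n"
    then obtain D where D: "((\<lambda>t. H j (u(i := t))) has_real_derivative D) (at (u i))"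
      "\<bar>D - (if i = j then 1 else 0)\<bar> \<le> e"
      using diff[of u i j] \<open>j < n\<close> by (auto simp: B_def)
    have "((\<lambda>t. (u(i := t)) j) has_real_derivative (if i = j then 1 else 0)) (at (u i))"
      by (cases "i = j") auto
    from DERIV_diff[OF D(1) this] D(2)
    show "\<exists>D. ((\<lambda>t. H j (u(i := t)) - (u(i := t)) j) has_real_derivative D) (at (u i)) \<and> \<bar>D\<bar> \<le> e"
      by blast
  qed
  have "2 * \<bar>y j - x j\<bar> - e * s \<le> \<bar>H j y - x j\<bar>" if "j < n" for j
    using err[OF that] unfolding Hx[OF that] by (smt (verit))
  then have "(\<Sum>j<n. 2 * \<bar>y j - x j\<bar> - e * s) \<le> (\<Sum>j<n. \<bar>H j y - x j\<bar>)"
    by (intro sum_mono) simp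
  moreover have "(\<Sum>j<n. 2 * \<bar>y j - x j\<bar> - e * s) = 2 * s - (real n * e) * s"
    by (simp add: sum_subtractf s_def flip: sum_distrib_left)
  moreover have "(real n * e) * s \<le> 1 / 2 * s"
    using e \<open>s \<ge> 0\<close> by (intro mult_right_mono)
  ultimately show ?thesis by (simp add: s_def)
qed

section \<open>Compact groups acting near a fixed point\<close>

text \<open>
  Every value is at most two thirds of the supremum, so the supremum is at most two thirds of itself.
\<close>
lemma bounded_self_improving_eq_0:
  fixes d :: "'a \<Rightarrow> real"
  assumes "\<And>a. a \<in> A \<Longrightarrow> 0 \<le> d a" "\<And>a. a \<in> A \<Longrightarrow> d a \<le> K"
    and "\<And>a. a \<in> A \<Longrightarrow> \<exists>b\<in>A. 3 / 2 * d a \<le> d b" and "a \<in> A"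
  shows "d a = 0"
proof -
  have bdd: "bdd_above (d ` A)" using assms(2) by (rule bdd_aboveI2)
  have "d x \<le> 2 / 3 * Sup (d ` A)" if x: "x \<in> A" for x
  proof -
    obtain b where b: "b \<in> A" "3 / 2 * d x \<le> d b" using assms(3)[OF x] by auto
    have "d b \<le> Sup (d ` A)" using b(1) bdd by (auto intro: cSup_upper)
    with b(2) show ?thesis by linarith
  qed
  then have "Sup (d ` A) \<le> 2 / 3 * Sup (d ` A)" using assms(4) by (intro cSup_least) auto
  moreover have "d a \<le> Sup (d ` A)" using assms(4) bdd by (auto intro: cSup_upper)
  ultimately show ?thesis using assms(1)[OF assms(4)] by linarith
qed

lemma compact_orbits_near_fixed_point:
  assumes "compact_space T" and cont: "continuous_map (prod_topology T X) X (\<lambda>(g, z). \<alpha> g z)"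
    and P: "openin X P" "z \<in> P" and fix_z: "\<And>g. g \<in> topspace T \<Longrightarrow> \<alpha> g z = z"
  obtains Q where "openin X Q" "z \<in> Q" "\<And>g q. g \<in> topspace T \<Longrightarrow> q \<in> Q \<Longrightarrow> \<alpha> g q \<in> P"
proof -
  have z: "z \<in> topspace X" using P openin_subset by blast
  let ?N = "{x \<in> topspace (prod_topology T X). (\<lambda>(g, z). \<alpha> g z) x \<in> P}"
  have N: "openin (prod_topology T X) ?N" using openin_continuous_map_preimage[OF cont P(1)] .
  have "topspace T \<times> {z} \<subseteq> ?N" using fix_z z P by auto
  from tube_lemma_left[OF N assms(1)[unfolded compact_space_def] z this]
  obtain U Q where Q: "topspace T \<subseteq> U" "openin X Q" "z \<in> Q" "U \<times> Q \<subseteq> ?N" by blast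
  show thesis
  proof (rule that[OF Q(2,3)])
    fix g q assume "g \<in> topspace T" "q \<in> Q"
    then have "(g, q) \<in> ?N" using Q(1,4) by blast
    then show "\<alpha> g q \<in> P" by simp
  qed
qed

text \<open>
  At a pair \<open>(g, a)\<close> with \<open>a \<in> A\<close> the map \<open>\<alpha> g\<close> is the identity near \<open>a\<close>, so its partial derivatives are
  those of the identity. With \<open>g0\<close> fixed, letting \<open>a\<close> tend to \<open>z\<close> gives the same values at \<open>(g0, z)\<close>; continuity in
  both arguments then gives nearby values on a neighbourhood in the product, the form in which the tube lemma
  can use them.
\<close>
lemma smooth_action_derivative_near_identity:
  fixes L :: "'g mfd" and M :: "'m mfd" and e :: real
  assumes L: "smooth_manifold L" and M: "smooth_manifold M"
    and smooth: "smooth_map (prod_mfd L M) M (\<lambda>(g, z). \<alpha> g z)"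
    and W: "(W, \<phi>) \<in> mfd_atlas M"
    and A: "openin (mfd_top M) A" and A_fixed: "\<And>g a. g \<in> points L \<Longrightarrow> a \<in> A \<Longrightarrow> \<alpha> g a = a"
    and z: "z \<in> W" "z \<in> mfd_top M closure_of A"
    and g0: "g0 \<in> points L" "\<alpha> g0 z = z" and "e > 0"
  obtains N where "openin (prod_topology (mfd_top L) (mfd_top M)) N" "(g0, z) \<in> N"
    and "\<And>g p. (g, p) \<in> N \<Longrightarrow> p \<in> W"
    and "\<And>g p i j. (g, p) \<in> N \<Longrightarrow> i < mfd_dim M \<Longrightarrow> j < mfd_dim M \<Longrightarrow>
      \<exists>D. ((\<lambda>t. chart_rep (W, \<phi>) (W, \<phi>) (\<alpha> g) j ((\<phi> p)(i := t))) has_real_derivative D) (at (\<phi> p i)) \<and>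
          \<bar>D - (if i = j then 1 else 0)\<bar> \<le> e"
proof -
  define X n where "X = prod_topology (mfd_top L) (mfd_top M)" and "n = mfd_dim M"
  obtain U \<theta> where U: "(U, \<theta>) \<in> mfd_atlas L" "g0 \<in> U"
    using L g0(1) unfolding smooth_manifold_def by fast
  have Uc: "is_chart (mfd_dim L) (mfd_top L) (U, \<theta>)" and Wc: "is_chart n (mfd_top M) (W, \<phi>)"
    using L M U(1) W by (auto simp: smooth_manifold_def n_def)
  define D where "D = {x \<in> U \<times> W. (\<lambda>(g, z). \<alpha> g z) x \<in> W}"
  define d where "d i j = (\<lambda>(g, p). partial_deriv i (chart_rep (W, \<phi>) (W, \<phi>) (\<alpha> g) j) (\<phi> p))" for i j
  define \<delta> :: "nat \<Rightarrow> nat \<Rightarrow> real" where "\<delta> i j = (if i = j then 1 else 0)" for i j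
  note partial = smooth_map_prod_partial_deriv[OF smooth U(1) Uc W Wc[unfolded n_def] W is_chartD(1)[OF Wc],
      folded D_def X_def n_def]
  have in_D: "(g0, z) \<in> D" using U(2) z(1) g0(2) by (simp add: D_def)
  have "continuous_map X (mfd_top M) (\<lambda>(g, z). \<alpha> g z)"
    using smooth by (simp add: smooth_map_def prod_mfd_def X_def)
  then have D: "openin X D"
    unfolding D_def X_def
    using openin_product_chart_domain is_chartD(1)[OF Uc] is_chartD(1)[OF Wc] by blast
  then have Dts: "topspace (subtopology X D) = D"
    using openin_subset by (metis topspace_subtopology_subset)
  have cont: "continuous_map (subtopology X D) euclideanreal (d i j)" if "i < n" "j < n" for i j
    using partial(2)[OF that] by (simp add: d_def)
  have open_pre: "openin X {x \<in> D. d i j x \<in> S}" if "i < n" "j < n" "open S" for i j S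
  proof -
    have "openin (subtopology X D) {x \<in> topspace (subtopology X D). d i j x \<in> S}"
      using openin_continuous_map_preimage[OF cont[OF that(1,2)]] that(3) by auto
    then show ?thesis unfolding Dts using D openin_open_subtopology by blast
  qed
  have at_z: "d i j (g0, z) = \<delta> i j" if ij: "i < n" "j < n" for i j
  proof (rule ccontr)
    assume "d i j (g0, z) \<noteq> \<delta> i j"
    then have "(g0, z) \<in> {x \<in> D. d i j x \<in> - {\<delta> i j}}" using in_D by simp
    moreover have "openin X {x \<in> D. d i j x \<in> - {\<delta> i j}}" by (intro open_pre ij open_Compl) simp
    ultimately obtain P Q where PQ: "openin (mfd_top M) Q" "g0 \<in> P" "z \<in> Q"
        "P \<times> Q \<subseteq> {x \<in> D. d i j x \<in> - {\<delta> i j}}"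
      unfolding X_def openin_prod_topology_alt by meson
    then obtain a where a: "a \<in> A" "a \<in> Q" using z(2) by (auto simp: in_closure_of)
    with PQ have "(g0, a) \<in> D" and ne: "d i j (g0, a) \<noteq> \<delta> i j" by auto
    then have "a \<in> W" by (simp add: D_def)
    have "d i j (g0, a) = \<delta> i j"
      unfolding d_def \<delta>_def prod.case
    proof (rule partial_deriv_chart_rep_identity[OF Wc])
      show "openin (mfd_top M) (A \<inter> W)" using A is_chartD(1)[OF Wc] by (rule openin_Int)
    qed (use a \<open>a \<in> W\<close> ij A_fixed g0 in auto)
    with ne show False ..
  qed
  define N where "N = D \<inter> ((\<Inter>(i, j)\<in>{..<n} \<times> {..<n}. {x \<in> D. d i j x \<in> ball (\<delta> i j) e}) \<inter> topspace X)"
  show thesis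
  proof (rule that[of N])
    have "openin X ((\<Inter>(i, j)\<in>{..<n} \<times> {..<n}. {x \<in> D. d i j x \<in> ball (\<delta> i j) e}) \<inter> topspace X)"
      by (rule openin_INT) (use open_pre[OF _ _ open_ball] in auto)
    then show "openin (prod_topology (mfd_top L) (mfd_top M)) N"
      using D by (auto simp: N_def X_def[symmetric])
    show "(g0, z) \<in> N" using in_D at_z \<open>e > 0\<close> openin_subset[OF D] by (auto simp: N_def)
    show "p \<in> W" if "(g, p) \<in> N" for g p using that by (auto simp: N_def D_def)
    fix g p i j assume gp: "(g, p) \<in> N" and "i < mfd_dim M" "j < mfd_dim M"
    then have ij: "i < n" "j < n" by (simp_all add: n_def)
    have "d i j (g, p) \<in> ball (\<delta> i j) e" using gp ij unfolding N_def by blast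
    then have close: "\<bar>d i j (g, p) - \<delta> i j\<bar> \<le> e" by (simp add: dist_real_def)
    have "(\<lambda>t. chart_rep (W, \<phi>) (W, \<phi>) (\<alpha> g) j ((\<phi> p)(i := t))) field_differentiable at (\<phi> p i)"
      using partial(1)[OF ij, of g p] gp by (simp add: N_def)
    from field_differentiable_derivI[OF this]
    have "((\<lambda>t. chart_rep (W, \<phi>) (W, \<phi>) (\<alpha> g) j ((\<phi> p)(i := t))) has_real_derivative d i j (g, p))
        (at (\<phi> p i))"
      by (simp only: d_def partial_deriv_def prod.case)
    with close show "\<exists>D. ((\<lambda>t. chart_rep (W, \<phi>) (W, \<phi>) (\<alpha> g) j ((\<phi> p)(i := t))) has_real_derivative D)
        (at (\<phi> p i)) \<and> \<bar>D - (if i = j then 1 else 0)\<bar> \<le> e"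
      unfolding \<delta>_def by (intro exI conjI)
  qed
qed

text \<open>
  The tube lemma is used twice: first for a box on which the derivatives of all \<open>\<alpha> g\<close> are uniformly close
  to the identity, then for a smaller neighbourhood \<open>Q\<close> whose orbits remain in that box. The second
  step is needed because the doubling estimate is applied at \<open>q\<close> and at \<open>\<alpha> g q\<close>, and because it
  makes the displacements bounded.
\<close>
lemma fixed_near_closure_of_interior:
  fixes G :: "('g, 'r) monoid_scheme" and L :: "'g mfd" and M :: "'m mfd"
  assumes G: "lie_group G L" and comp: "compact_space (mfd_top L)"
    and M: "smooth_manifold M" and act: "smooth_action G L M \<alpha>"
    and A: "openin (mfd_top M) A" and A_fixed: "\<And>g a. g \<in> carrier G \<Longrightarrow> a \<in> A \<Longrightarrow> \<alpha> g a = a"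
    and z: "z \<in> mfd_top M closure_of A" and z_fixed: "\<And>g. g \<in> carrier G \<Longrightarrow> \<alpha> g z = z"
  obtains Q where "openin (mfd_top M) Q" "z \<in> Q" "\<And>g q. g \<in> carrier G \<Longrightarrow> q \<in> Q \<Longrightarrow> \<alpha> g q = q"
proof -
  interpret group_action G "points M" \<alpha> using act by (simp add: smooth_action_def)
  have grp: "group G" and L: "smooth_manifold L" and carrier: "carrier G = points L"
    using G by (simp_all add: lie_group_def)
  have smooth: "smooth_map (prod_mfd L M) M (\<lambda>(g, z). \<alpha> g z)"
    using act by (simp add: smooth_action_def)
  then have cont: "continuous_map (prod_topology (mfd_top L) (mfd_top M)) (mfd_top M) (\<lambda>(g, z). \<alpha> g z)"
    by (simp add: smooth_map_def prod_mfd_def)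
  have one: "\<one>\<^bsub>G\<^esub> \<in> carrier G" using grp by (simp add: group.is_monoid)
  \<comment> \<open>Summing an error of \<open>e\<close> over \<open>n\<close> components has to cost at most one half, and \<open>e\<close> has to be
    positive even if \<open>n = 0\<close>.\<close>
  define n e where "n = mfd_dim M" and "e = 1 / (2 * (real n + 1))"
  have e: "e > 0" "real n * e \<le> 1 / 2" by (simp_all add: e_def field_simps)
  have zM: "z \<in> points M" using z by (simp add: in_closure_of)
  obtain W \<phi> where W: "(W, \<phi>) \<in> mfd_atlas M" "z \<in> W"
    using M zM unfolding smooth_manifold_def by fast
  have Wc: "is_chart n (mfd_top M) (W, \<phi>)" using M W(1) by (auto simp: smooth_manifold_def n_def)
  define h where "h g j = chart_rep (W, \<phi>) (W, \<phi>) (\<alpha> g) j" for g j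
  define good where "good g p \<longleftrightarrow> p \<in> W \<and> (\<forall>i<n. \<forall>j<n.
      \<exists>D. ((\<lambda>t. h g j ((\<phi> p)(i := t))) has_real_derivative D) (at (\<phi> p i)) \<and>
          \<bar>D - (if i = j then 1 else 0)\<bar> \<le> e)" for g p
  have "\<exists>N. openin (prod_topology (mfd_top L) (mfd_top M)) N \<and> (g, z) \<in> N \<and> (\<forall>(g, p)\<in>N. good g p)"
    if g: "g \<in> points L" for g
  proof -
    have A': "\<And>g a. g \<in> points L \<Longrightarrow> a \<in> A \<Longrightarrow> \<alpha> g a = a" using A_fixed carrier by simp
    have gz: "\<alpha> g z = z" using z_fixed g carrier by simp
    from smooth_action_derivative_near_identity[OF L M smooth W(1) A A' W(2) z g gz e(1)]
    show ?thesis unfolding good_def n_def h_def by (smt (verit) case_prodI2)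
  qed
  then obtain N where N: "\<And>g. g \<in> points L \<Longrightarrow> openin (prod_topology (mfd_top L) (mfd_top M)) (N g)"
    "\<And>g. g \<in> points L \<Longrightarrow> (g, z) \<in> N g" "\<And>g g' p. g \<in> points L \<Longrightarrow> (g', p) \<in> N g \<Longrightarrow> good g' p"
    by (metis (no_types, lifting) case_prodD)
  have N': "openin (prod_topology (mfd_top L) (mfd_top M)) (\<Union>g\<in>points L. N g)" using N(1) by blast
  have "points L \<times> {z} \<subseteq> (\<Union>g\<in>points L. N g)" using N(2) by auto
  from tube_lemma_left[OF N' comp[unfolded compact_space_def] zM this]
  obtain R P where RP: "points L \<subseteq> R" "openin (mfd_top M) P" "z \<in> P"
      "R \<times> P \<subseteq> (\<Union>g\<in>points L. N g)" by blast
  have good: "good g p" if "g \<in> carrier G" "p \<in> P" for g p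
    using that RP N(3) carrier by blast
  have "P \<subseteq> W" using good[OF one] by (auto simp: good_def)
  obtain r where r: "r > 0"
    "\<And>x. x \<in> topspace (Euclidean_space n) \<Longrightarrow> (\<And>i. i < n \<Longrightarrow> \<bar>x i - \<phi> z i\<bar> < r) \<Longrightarrow> x \<in> \<phi> ` P"
    using Euclidean_space_open_contains_box[OF is_chartD(5)[OF Wc RP(2) \<open>P \<subseteq> W\<close>] imageI[OF RP(3)]] by metis
  define B where "B = {x \<in> topspace (Euclidean_space n). \<forall>i<n. \<bar>x i - \<phi> z i\<bar> < r}"
  define P' where "P' = {p \<in> W. \<forall>i<n. \<bar>\<phi> p i - \<phi> z i\<bar> < r}"
  have "openin (mfd_top M) P'" unfolding P'_def by (rule openin_chart_box[OF Wc])
  moreover have "z \<in> P'" using W(2) r(1) by (simp add: P'_def)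
  ultimately obtain Q where Q: "openin (mfd_top M) Q" "z \<in> Q"
      "\<And>g q. g \<in> carrier G \<Longrightarrow> q \<in> Q \<Longrightarrow> \<alpha> g q \<in> P'"
    using compact_orbits_near_fixed_point[OF comp cont] z_fixed carrier by metis
  have P'B: "\<phi> p \<in> B" if "p \<in> P'" for p
    using that is_chartD(3)[OF Wc] by (auto simp: P'_def B_def)
  have "\<alpha> g q = q" if g: "g \<in> carrier G" and q: "q \<in> Q" for g q
  proof -
    have qM: "q \<in> points M" using Q(1) q openin_subset by blast
    have qP': "q \<in> P'" using Q(3)[OF one q] qM by (simp flip: id_eq_one)
    define d where "d g = (\<Sum>i<n. \<bar>\<phi> (\<alpha> g q) i - \<phi> q i\<bar>)" for g
    have "d g = 0"
    proof (rule bounded_self_improving_eq_0[where A = "carrier G" and K = "\<Sum>i<n. 2 * r"])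
      fix g assume g: "g \<in> carrier G"
      have gq: "\<alpha> g q \<in> P'" by (rule Q(3)[OF g q])
      have gg: "g \<otimes>\<^bsub>G\<^esub> g \<in> carrier G" using g grp by (simp add: group.is_monoid monoid.m_closed)
      show "0 \<le> d g" by (simp add: d_def sum_nonneg)
      show "d g \<le> (\<Sum>i<n. 2 * r)" unfolding d_def
      proof (rule sum_mono)
        fix i assume "i \<in> {..<n}"
        then have "\<bar>\<phi> (\<alpha> g q) i - \<phi> z i\<bar> < r" "\<bar>\<phi> q i - \<phi> z i\<bar> < r"
          using gq qP' by (auto simp: P'_def)
        then show "\<bar>\<phi> (\<alpha> g q) i - \<phi> q i\<bar> \<le> 2 * r" by linarith
      qed
      have rep: "h g j (\<phi> p) = \<phi> (\<alpha> g p) j" if "p \<in> P'" for p j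
        unfolding h_def using that by (intro chart_rep_apply[OF is_chartD(2)[OF Wc]]) (simp add: P'_def)
      have "3 / 2 * (\<Sum>j<n. \<bar>\<phi> (\<alpha> g q) j - \<phi> q j\<bar>) \<le> (\<Sum>j<n. \<bar>h g j (\<phi> (\<alpha> g q)) - \<phi> q j\<bar>)"
      proof (rule near_identity_doubling[where H = "h g" and c = "\<phi> z" and r = r and e = e and n = n, folded B_def])
        fix x i j assume x: "x \<in> B" and ij: "i < n" "j < n"
        obtain p where "p \<in> P" "x = \<phi> p" using r(2)[of x] x by (auto simp: B_def)
        then show "\<exists>D. ((\<lambda>t. h g j (x(i := t))) has_real_derivative D) (at (x i)) \<and>
            \<bar>D - (if i = j then 1 else 0)\<bar> \<le> e"
          using good[OF g \<open>p \<in> P\<close>] ij by (simp add: good_def)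
      qed (use e P'B gq qP' rep in auto)
      also have "\<dots> = d (g \<otimes>\<^bsub>G\<^esub> g)"
        using composition_rule[OF qM g g] by (simp add: d_def rep[OF gq])
      finally have "3 / 2 * d g \<le> d (g \<otimes>\<^bsub>G\<^esub> g)" by (simp add: d_def)
      with gg show "\<exists>b\<in>carrier G. 3 / 2 * d g \<le> d b" ..
    qed (fact g)
    then have "\<phi> (\<alpha> g q) i = \<phi> q i" if "i < n" for i
      using that by (simp add: d_def sum_nonneg_eq_0_iff)
    moreover have "\<phi> (\<alpha> g q) \<in> B" "\<phi> q \<in> B" using P'B Q(3)[OF g q] qP' by auto
    ultimately have "\<phi> (\<alpha> g q) = \<phi> q"
      by (auto simp: B_def topspace_Euclidean_space fun_eq_iff) (metis not_le)
    then show ?thesis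
      using is_chartD(2)[OF Wc] Q(3)[OF g q] qP' by (auto simp: P'_def inj_on_def)
  qed
  with Q(1,2) show thesis by (rule that)
qed

section \<open>The fixed point set\<close>

lemma closedin_fixed_points:
  assumes "Hausdorff_space X" and cont: "continuous_map (prod_topology T X) X (\<lambda>(g, z). \<alpha> g z)"
    and "topspace T \<noteq> {}"
  shows "closedin X {z \<in> topspace X. \<forall>g\<in>topspace T. \<alpha> g z = z}"
proof -
  have "closedin X {z \<in> topspace X. \<alpha> g z = z}" if "g \<in> topspace T" for g
  proof (rule closedin_continuous_maps_eq[OF assms(1)])
    have "continuous_map X (prod_topology T X) (\<lambda>z. (g, z))"
      using that by (intro continuous_map_pairedI) auto
    from continuous_map_compose[OF this cont] show "continuous_map X X (\<alpha> g)"
      by (simp add: comp_def)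
    show "continuous_map X X (\<lambda>z. z)" by simp
  qed
  then have "closedin X (\<Inter>g\<in>topspace T. {z \<in> topspace X. \<alpha> g z = z})"
    using assms(3) by (intro closedin_INT) auto
  moreover have "(\<Inter>g\<in>topspace T. {z \<in> topspace X. \<alpha> g z = z}) =
      {z \<in> topspace X. \<forall>g\<in>topspace T. \<alpha> g z = z}"
    using assms(3) by (auto simp del: null_topspace_iff_trivial)
  ultimately show ?thesis by simp
qed

theorem theorem1p3:
  fixes G :: "('g, 'r) monoid_scheme"
    and L :: "'g mfd"
    and M :: "'m mfd"
    and \<alpha> :: "'g \<Rightarrow> 'm \<Rightarrow> 'm"
  assumes "lie_group G L"
    and "compact_space (mfd_top L)"
    and "smooth_manifold M"
    and "connected_space (mfd_top M)"
    and "smooth_action G L M \<alpha>"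
    and "\<exists>g\<in>carrier G. \<exists>z\<in>points M. \<alpha> g z \<noteq> z"
  shows "nowhere_dense_in (mfd_top M) {z \<in> points M. \<forall>g\<in>carrier G. \<alpha> g z = z}"
proof -
  define F where "F = {z \<in> points M. \<forall>g\<in>carrier G. \<alpha> g z = z}"
  define A where "A = mfd_top M interior_of F"
  have carrier: "carrier G = points L" using assms(1) by (simp add: lie_group_def)
  have cont: "continuous_map (prod_topology (mfd_top L) (mfd_top M)) (mfd_top M) (\<lambda>(g, z). \<alpha> g z)"
    using assms(5) by (simp add: smooth_action_def smooth_map_def prod_mfd_def)
  have closed_F: "closedin (mfd_top M) F"
    unfolding F_def carrier
    by (rule closedin_fixed_points[OF _ cont]) (use assms(3,6) carrier in \<open>auto simp: smooth_manifold_def\<close>)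
  have AF: "A \<subseteq> F" and A: "openin (mfd_top M) A" by (auto simp: A_def interior_of_subset)
  have "mfd_top M closure_of A \<subseteq> A"
  proof
    fix z assume z: "z \<in> mfd_top M closure_of A"
    then have "z \<in> F" using closure_of_minimal[OF AF closed_F] by blast
    then have z_fixed: "\<And>g. g \<in> carrier G \<Longrightarrow> \<alpha> g z = z" by (simp add: F_def)
    have A_fixed: "\<And>g a. g \<in> carrier G \<Longrightarrow> a \<in> A \<Longrightarrow> \<alpha> g a = a" using AF by (auto simp: F_def)
    obtain Q where Q: "openin (mfd_top M) Q" "z \<in> Q" "\<And>g q. g \<in> carrier G \<Longrightarrow> q \<in> Q \<Longrightarrow> \<alpha> g q = q"
      using fixed_near_closure_of_interior[OF assms(1,2,3,5) A A_fixed z z_fixed] by metis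
    then have "Q \<subseteq> F" using openin_subset[OF Q(1)] by (auto simp: F_def)
    with Q(1,2) show "z \<in> A" unfolding A_def using interior_of_maximal by blast
  qed
  then have "closedin (mfd_top M) A"
    using closure_of_subset_eq openin_subset[OF A] by blast
  then have "A = {} \<or> A = points M"
    using assms(4) A by (auto simp: connected_space_clopen_in)
  moreover have "A \<noteq> points M" using AF assms(6) by (auto simp: F_def)
  ultimately have "A = {}" by blast
  then show ?thesis
    using closure_of_closedin[OF closed_F] closedin_subset[OF closed_F]
    by (simp add: nowhere_dense_in_def A_def flip: F_def)
qed

end
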